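(* Let $n\ge 2$, let $c>0$, and let $f(x)=e^{cx}-1$ be the weight function of a winners-pay quasi-proportional auction with $n$ bidders having private values $v_1,\dots,v_n>0$. If $\mathbf{b}^*=(b_1^*,\dots,b_n^* )\in[0,\infty)^n$ is a pure-strategy Nash equilibrium with at least two positive bids, then for every $i\in\{1,\dots,n\}$, $$ b^*_i = v_i - \frac{1}{c}\left(1-\frac{1}{e^{c b^*_i}}\right)\left(\frac{1}{1-a_i(\mathbf{b}^* )}\right). $$
   Context: Winners-pay quasi-proportional auction: each bidder $i$ submits a bid $b_i\ge 0$. Given the bid vector $\mathbf{b}=(b_1,\dots,b_n)$ and a weight function $f$, bidder $i$ receives the allocation $a_i(\mathbf{b})=\frac{f(b_i)}{\sum_{j=1}^n f(b_j)}$ (defined when the denominator is nonzero) and has utility $u_i(\mathbf{b})=(v_i-b_i)\,a_i(\mathbf{b})$, where $v_i$ is bidder $i$'s private value for a full allocation. A bid vector $\mathbf{b}^*$ with at least two positive bids is a pure-strategy Nash equilibrium if, for every $i$, $b_i^*$ maximizes bidder $i$'s utility over bids in $[0,\infty)$ when the other bidders' bids are held fixed at $b_j^*$, $j\ne i$. *)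

theory Defs
  imports "HOL-Analysis.Analysis"
begin

text \<open>Bidders are \<open>1, \<dots>, n\<close>; bid and value vectors are functions on \<open>nat\<close> whose entries outside
  \<open>{1..n}\<close> play no role. The division convention \<open>x / 0 = 0\<close> is visible only when all weights
  sum to zero.\<close>

definition allocation :: "nat \<Rightarrow> (real \<Rightarrow> real) \<Rightarrow> (nat \<Rightarrow> real) \<Rightarrow> nat \<Rightarrow> real" where
  "allocation n f b i = f (b i) / (\<Sum>j=1..n. f (b j))"

definition utility ::
    "nat \<Rightarrow> (real \<Rightarrow> real) \<Rightarrow> (nat \<Rightarrow> real) \<Rightarrow> (nat \<Rightarrow> real) \<Rightarrow> nat \<Rightarrow> real" where
  "utility n f v b i = (v i - b i) * allocation n f b i"

text \<open>The equilibrium notion applies only to bid vectors with at least two positive bids. If \<open>f\<close> is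
  nonnegative on \<open>[0, \<infinity>)\<close> and positive on \<open>(0, \<infinity>)\<close>, a unilateral deviation then never makes the sum
  of the weights zero.\<close>

definition pure_nash_equilibrium ::
    "nat \<Rightarrow> (real \<Rightarrow> real) \<Rightarrow> (nat \<Rightarrow> real) \<Rightarrow> (nat \<Rightarrow> real) \<Rightarrow> bool" where
  "pure_nash_equilibrium n f v b \<longleftrightarrow>
     (\<forall>i\<in>{1..n}. 0 \<le> b i) \<and>
     2 \<le> card {i \<in> {1..n}. 0 < b i} \<and>
     (\<forall>i\<in>{1..n}. \<forall>x\<ge>0. utility n f v (b(i := x)) i \<le> utility n f v b i)"

end

theory Submission
  imports Defs
begin

text \<open>With the other bids fixed, a bidder facing the total opposing weight \<open>S > 0\<close> maximizes
  \<open>(v - x) f(x) / (f(x) + S)\<close>. A bid \<open>0\<close> earns nothing while every bid in \<open>(0, v)\<close> earns a positive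
  amount, so the equilibrium bid is an interior maximum, and the claim is the first-order condition
  there, solved for the bid.\<close>

lemma utility_fun_upd:
  assumes "i \<in> {1..n}"
  shows "utility n f v (b(i := x)) i = (v i - x) * (f x / (f x + (\<Sum>j\<in>{1..n}-{i}. f (b j))))"
proof -
  have "(\<Sum>j=1..n. f ((b(i := x)) j)) = f x + (\<Sum>j\<in>{1..n}-{i}. f ((b(i := x)) j))"
    using assms by (simp add: sum.remove)
  also have "(\<Sum>j\<in>{1..n}-{i}. f ((b(i := x)) j)) = (\<Sum>j\<in>{1..n}-{i}. f (b j))"
    by (rule sum.cong) auto
  finally show ?thesis
    by (simp add: utility_def allocation_def)
qed

text \<open>Of two positive bids at least one is not that of \<open>i\<close>, and its weight alone
  makes the sum positive. Hence no deviation of \<open>i\<close> to a nonnegative bid meets a zero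
  denominator.\<close>

lemma opposing_weight_pos:
  fixes f :: "real \<Rightarrow> real" and b :: "nat \<Rightarrow> real"
  assumes "2 \<le> card {j \<in> {1..n}. 0 < b j}" and "\<forall>j\<in>{1..n}. 0 \<le> b j"
    and nonneg: "\<And>x. 0 \<le> x \<Longrightarrow> 0 \<le> f x" and pos: "\<And>x. 0 < x \<Longrightarrow> 0 < f x"
  shows "0 < (\<Sum>j\<in>{1..n}-{i}. f (b j))"
proof -
  have "\<not> {j \<in> {1..n}. 0 < b j} \<subseteq> {i}"
    using assms(1) card_mono[of "{i}" "{j \<in> {1..n}. 0 < b j}"] by auto
  then obtain k where "k \<in> {1..n}-{i}" "0 < b k"
    by auto
  then show ?thesis
    using assms(2) nonneg pos by (intro sum_pos2[of _ k]) auto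
qed

text \<open>In the numerator of the derivative the two terms \<open>(v - x) * f x * D\<close>
  cancel, which leaves \<open>(v - x) * D * S - f x * (f x + S)\<close>. This vanishes at an
  interior maximum.\<close>

lemma first_order_condition:
  fixes f :: "real \<Rightarrow> real"
  assumes deriv: "(f has_real_derivative D) (at x)" and "0 < x" and denom: "f x + S \<noteq> 0"
    and max: "\<And>y. 0 \<le> y \<Longrightarrow> (v - y) * (f y / (f y + S)) \<le> (v - x) * (f x / (f x + S))"
  shows "(v - x) * D * S = f x * (f x + S)"
proof -
  let ?l = "((D * (v - x) - f x) * (f x + S) - (v - x) * f x * D) / (f x + S)\<^sup>2"
  have "((\<lambda>y. (v - y) * (f y / (f y + S))) has_real_derivative ?l) (at x)"
    using denom by (auto intro!: derivative_eq_intros deriv simp: power2_eq_square)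
  \<comment> \<open>The radius of the neighbourhood is \<open>x\<close> itself: every
    \<open>y\<close> with \<open>\<bar>x - y\<bar> < x\<close> is positive, so \<open>max\<close>
    covers it.\<close>
  then have "?l = 0"
    using \<open>0 < x\<close> by (rule DERIV_local_max) (intro allI impI max, linarith)
  then show ?thesis
    using denom by (simp add: algebra_simps)
qed

theorem theorem2p2:
  fixes n :: nat and c :: real and f :: "real \<Rightarrow> real" and v b :: "nat \<Rightarrow> real"
  assumes "n \<ge> 2"
    and "c > 0"
    and "f = (\<lambda>x. exp (c * x) - 1)"
    and "\<forall>i\<in>{1..n}. v i > 0"
    and "\<forall>i\<in>{1..n}. b i \<ge> 0"
    and "card {i \<in> {1..n}. b i > 0} \<ge> 2"
    and "pure_nash_equilibrium n f v b"
  shows "\<forall>i\<in>{1..n}. b i = v i - 1 / c * (1 - 1 / exp (c * b i)) * (1 / (1 - allocation n f b i))"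
proof
  fix i assume i: "i \<in> {1..n}"
  define S where "S = (\<Sum>j\<in>{1..n}-{i}. f (b j))"
  have f_nonneg: "0 \<le> f x" if "0 \<le> x" for x
    using that \<open>c > 0\<close> by (simp add: assms(3))
  have f_pos: "0 < f x" if "0 < x" for x
    using that \<open>c > 0\<close> by (simp add: assms(3))
  have S: "0 < S"
    unfolding S_def using assms(5,6) f_nonneg f_pos by (intro opposing_weight_pos) auto
  have max: "(v i - y) * (f y / (f y + S)) \<le> (v i - b i) * (f (b i) / (f (b i) + S))"
    if "0 \<le> y" for y
  proof -
    \<comment> \<open>Writing \<open>b\<close> as \<open>b(i := b i)\<close> lets one formula in
      \<open>S\<close> evaluate both sides.\<close>
    have "utility n f v (b(i := y)) i \<le> utility n f v (b(i := b i)) i"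
      using assms(7) i that by (simp add: pure_nash_equilibrium_def)
    then show ?thesis
      unfolding utility_fun_upd[OF i] S_def .
  qed
  have "b i \<noteq> 0"
  proof
    assume "b i = 0"
    \<comment> \<open>The right-hand side is 0 because \<open>f 0 = 0\<close>. Half the value is
      just one convenient bid strictly between 0 and \<open>v i\<close>.\<close>
    then have "(v i - v i / 2) * (f (v i / 2) / (f (v i / 2) + S)) \<le> 0"
      using max[of "v i / 2"] assms(4) i by (simp add: assms(3) less_imp_le)
    moreover have "0 < (v i - v i / 2) * (f (v i / 2) / (f (v i / 2) + S))"
      using assms(4) i S f_pos[of "v i / 2"] by (intro mult_pos_pos divide_pos_pos add_pos_pos) auto
    ultimately show False by linarith
  qed
  then have bi: "0 < b i"
    using assms(5) i by force
  have fS: "0 < f (b i) + S"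
    using f_pos[OF bi] S by linarith
  have "(f has_real_derivative c * exp (c * b i)) (at (b i))"
    unfolding assms(3) by (auto intro!: derivative_eq_intros)
  then have foc: "(v i - b i) * (c * exp (c * b i)) * S = f (b i) * (f (b i) + S)"
    using bi fS max by (intro first_order_condition) auto
  have "allocation n f b i = f (b i) / (f (b i) + S)"
    using i by (simp add: allocation_def S_def sum.remove)
  then have "1 - allocation n f b i = S / (f (b i) + S)"
    using fS by (simp add: field_simps)
  then have share: "1 / (1 - allocation n f b i) = (f (b i) + S) / S"
    by simp
  have "1 - 1 / exp (c * b i) = f (b i) / exp (c * b i)"
    by (simp add: assms(3) diff_divide_distrib)
  then have "1 / c * (1 - 1 / exp (c * b i)) * (1 / (1 - allocation n f b i))
      = f (b i) * (f (b i) + S) / (c * exp (c * b i) * S)"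
    unfolding share by simp
  \<comment> \<open>Read from right to left, \<open>foc\<close> turns the numerator into
    \<open>v i - b i\<close> times the denominator.\<close>
  also have "\<dots> = v i - b i"
    using \<open>c > 0\<close> S by (simp add: foc[symmetric])
  finally show "b i = v i - 1 / c * (1 - 1 / exp (c * b i)) * (1 / (1 - allocation n f b i))"
    by simp
qed

end
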